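(* For any $\varepsilon > 0$ there exist polynomials $x, y \in \mathbb{Z}[t]$ such that $x^3 \neq y^2$ and $\deg(x^3 - y^2)/\deg(x) < 1/2 + \varepsilon$. More precisely, for any even positive integer $\delta$ there exist polynomials $x, y \in \mathbb{Z}[t]$ such that $\deg(x) = 2\delta$, $\deg(y) = 3\delta$ and $\deg(x^3 - y^2) = \delta + 5$. *)

theory Defs
  imports Complex_Main "HOL-Computational_Algebra.Polynomial"
begin

end

theory Submission
  imports Defs
begin

text \<open>
  The \<open>c\<^sub>4\<close>, \<open>c\<^sub>6\<close> and discriminant of the universal elliptic curve over \<open>X\<^sub>1(5)\<close>, written in terms of
  the parameter \<open>s = w - 1/w\<close>, give the identity
  \<open>(s\<^sup>2 - 12s + 16)\<^sup>3 - (s\<^sup>2 + 4)(s\<^sup>2 - 18s + 76)\<^sup>2 = 1728(s - 11)\<close>.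
  If \<open>s, z \<in> \<int>[t]\<close> satisfy the Pell equation \<open>s\<^sup>2 + 4 = Dz\<^sup>2\<close> with \<open>D = t\<^sup>2 + 1\<close>, multiplication by \<open>D\<^sup>3\<close>
  turns it into \<open>x\<^sup>3 - y\<^sup>2 = 1728D\<^sup>3(s - 11)\<close> for \<open>x = D(s\<^sup>2 - 12s + 16)\<close> and
  \<open>y = D\<^sup>2z(s\<^sup>2 - 18s + 76)\<close>. The odd powers of the unit \<open>t + \<surd>D\<close>, which has norm \<open>-1\<close>, provide
  solutions \<open>s\<close> of every odd degree; then \<open>\<delta> = deg s + 1\<close>.
\<close>

lemma X1_5_identity:
  fixes s :: "'a::comm_ring_1"
  shows "(s ^ 2 - 12 * s + 16) ^ 3 - (s ^ 2 + 4) * (s ^ 2 - 18 * s + 76) ^ 2 = 1728 * (s - 11)"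
  by (simp add: power2_eq_square power3_eq_cube algebra_simps)

lemma twisted_X1_5_identity:
  fixes s z d :: "'a::comm_ring_1"
  assumes "s ^ 2 + 4 = d * z ^ 2"
  shows "(d * (s ^ 2 - 12 * s + 16)) ^ 3 - (d ^ 2 * z * (s ^ 2 - 18 * s + 76)) ^ 2
         = 1728 * d ^ 3 * (s - 11)"
proof -
  have twist: "(d * a) ^ 3 - (d ^ 2 * z * b) ^ 2 = d ^ 3 * (a ^ 3 - d * z ^ 2 * b ^ 2)" for a b
    by (simp add: power2_eq_square power3_eq_cube algebra_simps)
  show ?thesis
    unfolding twist assms[symmetric] X1_5_identity by (simp add: ac_simps)
qed

lemma degree_add_pos_lead_coeff:
  fixes p q :: "'a::linordered_idom poly"
  assumes "degree p = degree q" "lead_coeff p > 0" "lead_coeff q > 0"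
  shows "degree (p + q) = degree p" "lead_coeff (p + q) > 0"
proof -
  have pos: "coeff (p + q) (degree p) > 0"
    using assms by simp
  then have "degree p \<le> degree (p + q)"
    by (intro le_degree) simp
  moreover have "degree (p + q) \<le> degree p"
    using assms(1) by (intro degree_add_le) simp_all
  ultimately show "degree (p + q) = degree p"
    by simp
  with pos show "lead_coeff (p + q) > 0"
    by simp
qed

text \<open>Positive leading coefficients are carried along so that, in the induction step, the two
  summands of equal degree in \<open>s'\<close> and in \<open>z'\<close> cannot cancel at the
  top.\<close>

lemma pell_polynomial_solutions:
  "\<exists>s z :: int poly. s ^ 2 + 4 = [:1, 0, 1:] * z ^ 2 \<and>
     degree s = 2 * n + 1 \<and> degree z = 2 * n \<and> lead_coeff s > 0 \<and> lead_coeff z > 0"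
proof (induction n)
  case 0
  \<comment> \<open>Twice the unit \<open>t + \<surd>D\<close> of norm -1, hence norm -4.\<close>
  have "[:0, 2:] ^ 2 + 4 = ([:1, 0, 1:] :: int poly) * [:2:] ^ 2"
    by (simp add: power2_eq_square numeral_poly)
  then show ?case
    by (intro exI[of _ "[:0, 2:]"] exI[of _ "[:2:]"]) simp
next
  case (Suc n)
  then obtain s z :: "int poly" where
    pell: "s ^ 2 + 4 = [:1, 0, 1:] * z ^ 2" and
    deg: "degree s = 2 * n + 1" "degree z = 2 * n" and
    lead: "lead_coeff s > 0" "lead_coeff z > 0"
    by blast
  have nz: "s \<noteq> 0" "z \<noteq> 0"
    using lead by auto
  define d e f :: "int poly" where "d = [:1, 0, 1:]" and "e = [:1, 0, 2:]" and "f = [:0, 2:]"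
  \<comment> \<open>multiplication by \<open>(t + \<surd>D)\<^sup>2 = e + f\<surd>D\<close>\<close>
  define s' z' where "s' = e * s + f * d * z" and "z' = e * z + f * s"
  have def_deg: "degree d = 2" "degree e = 2" "degree f = 1" "d \<noteq> 0" "e \<noteq> 0" "f \<noteq> 0"
    and def_lead: "lead_coeff d = 1" "lead_coeff e = 2" "lead_coeff f = 2"
    by (simp_all add: d_def e_def f_def)
  have norm: "e ^ 2 - d * f ^ 2 = 1"
    by (simp add: d_def e_def f_def power2_eq_square)
  \<comment> \<open>Multiplicativity of the norm (Brahmagupta's identity).\<close>
  have "s' ^ 2 - d * z' ^ 2 = (e ^ 2 - d * f ^ 2) * (s ^ 2 - d * z ^ 2)"
    unfolding s'_def z'_def by (simp add: power2_eq_square algebra_simps)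
  also have "\<dots> = - 4"
    unfolding norm pell[folded d_def, symmetric] by simp
  finally have "s' ^ 2 + 4 = d * z' ^ 2"
    by (simp add: algebra_simps)
  moreover have "degree (e * s) = 2 * n + 3" "degree (f * d * z) = 2 * n + 3"
    "degree (e * z) = 2 * n + 2" "degree (f * s) = 2 * n + 2"
    using nz deg def_deg by (simp_all add: degree_mult_eq)
  moreover have "lead_coeff (e * s) > 0" "lead_coeff (f * d * z) > 0"
    "lead_coeff (e * z) > 0" "lead_coeff (f * s) > 0"
    unfolding lead_coeff_mult using lead def_lead by simp_all
  ultimately have "s' ^ 2 + 4 = d * z' ^ 2"
    "degree s' = 2 * Suc n + 1" "degree z' = 2 * Suc n" "lead_coeff s' > 0" "lead_coeff z' > 0"
    using degree_add_pos_lead_coeff[of "e * s" "f * d * z"]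
      degree_add_pos_lead_coeff[of "e * z" "f * s"]
    unfolding s'_def z'_def by simp_all
  then show ?case
    unfolding d_def by blast
qed

lemma hall_polynomials_exist:
  fixes \<delta> :: nat
  assumes "\<delta> > 0" "even \<delta>"
  shows "\<exists>x y :: int poly. degree x = 2 * \<delta> \<and> degree y = 3 * \<delta> \<and>
           degree (x ^ 3 - y ^ 2) = \<delta> + 5"
proof -
  \<comment> \<open>A positive even \<open>\<delta>\<close> is at least 2, so the subtraction does
    not truncate.\<close>
  have "\<delta> = 2 * (\<delta> div 2 - 1) + 2"
    using assms by presburger
  then obtain n where \<delta>: "\<delta> = 2 * n + 2" ..
  obtain s z :: "int poly" where
    pell: "s ^ 2 + 4 = [:1, 0, 1:] * z ^ 2" and
    deg: "degree s = 2 * n + 1" "degree z = 2 * n" and lead: "lead_coeff z > 0"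
    using pell_polynomial_solutions[of n] by blast
  define d :: "int poly" where "d = [:1, 0, 1:]"
  have d: "d \<noteq> 0" "degree d = 2"
    by (simp_all add: d_def)
  have z: "z \<noteq> 0"
    using lead by auto
  define a b c where "a = s ^ 2 - 12 * s + 16" and "b = s ^ 2 - 18 * s + 76" and "c = s - 11"
  \<comment> \<open>Composition multiplies degrees, which avoids estimating the lower terms.\<close>
  have "a = [:16, -12, 1:] \<circ>\<^sub>p s" "b = [:76, -18, 1:] \<circ>\<^sub>p s" "c = [:-11, 1:] \<circ>\<^sub>p s"
    by (simp_all add: a_def b_def c_def pcompose_pCons power2_eq_square numeral_poly algebra_simps)
  then have degs: "degree a = 2 * (2 * n + 1)" "degree b = 2 * (2 * n + 1)" "degree c = 2 * n + 1"
    using deg by (simp_all only: degree_pcompose) simp_all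
  then have nz: "a \<noteq> 0" "b \<noteq> 0" "c \<noteq> 0"
    by auto
  have "(d * a) ^ 3 - (d ^ 2 * z * b) ^ 2 = 1728 * d ^ 3 * c"
    unfolding a_def b_def c_def using pell twisted_X1_5_identity d_def by blast
  \<comment> \<open>The count is \<open>3 * 2 + (2 * n + 1) = \<delta> + 5\<close>.\<close>
  moreover have "degree (1728 * d ^ 3 * c) = \<delta> + 5"
    using d nz degs by (simp add: \<delta> degree_mult_eq degree_power_eq)
  moreover have "degree (d * a) = 2 * \<delta>"
    using d nz degs by (simp add: \<delta> degree_mult_eq)
  moreover have "degree (d ^ 2 * z * b) = 3 * \<delta>"
    using d z nz degs deg by (simp add: \<delta> degree_mult_eq degree_power_eq)
  ultimately show ?thesis
    by metis
qed

theorem theorem1: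
  shows "(\<forall>\<epsilon>::real. \<epsilon> > 0 \<longrightarrow>
           (\<exists>x y :: int poly. x ^ 3 \<noteq> y ^ 2 \<and> degree x > 0 \<and>
              real (degree (x ^ 3 - y ^ 2)) / real (degree x) < 1 / 2 + \<epsilon>))
       \<and> (\<forall>\<delta>::nat. \<delta> > 0 \<and> even \<delta> \<longrightarrow>
           (\<exists>x y :: int poly. degree x = 2 * \<delta> \<and> degree y = 3 * \<delta> \<and>
              degree (x ^ 3 - y ^ 2) = \<delta> + 5))"
proof (intro conjI allI impI)
  fix \<epsilon> :: real
  assume "\<epsilon> > 0"
  \<comment> \<open>For \<open>\<delta> = 2 * n\<close> the quotient is
    \<open>1/2 + 5/(4 * n)\<close>, so this bound suffices.\<close>
  obtain n :: nat where n: "real n > 5 / \<epsilon>"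
    using reals_Archimedean2 by blast
  with \<open>\<epsilon> > 0\<close> have "n > 0"
    by (metis divide_pos_pos less_trans of_nat_0_less_iff zero_less_numeral)
  then obtain x y :: "int poly" where
    deg: "degree x = 2 * (2 * n)" "degree (x ^ 3 - y ^ 2) = 2 * n + 5"
    using hall_polynomials_exist[of "2 * n"] by auto
  \<comment> \<open>The zero polynomial has degree 0, not \<open>2 * n + 5\<close>.\<close>
  have "x ^ 3 \<noteq> y ^ 2"
    using deg(2) by auto
  moreover have "real (2 * n + 5) / real (2 * (2 * n)) < 1 / 2 + \<epsilon>"
  proof -
    have "5 < \<epsilon> * real n"
      using n \<open>\<epsilon> > 0\<close> by (simp add: field_simps)
    moreover have "0 < \<epsilon> * real n"
      using \<open>\<epsilon> > 0\<close> \<open>n > 0\<close> by simp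
    ultimately show ?thesis
      using \<open>n > 0\<close> by (simp add: field_simps)
  qed
  ultimately show "\<exists>x y :: int poly. x ^ 3 \<noteq> y ^ 2 \<and> degree x > 0 \<and>
      real (degree (x ^ 3 - y ^ 2)) / real (degree x) < 1 / 2 + \<epsilon>"
    using deg \<open>n > 0\<close> by (intro exI[of _ x] exI[of _ y]) simp
qed (use hall_polynomials_exist in blast)

end
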